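(* Let $q$ be a prime, $F=\mathbb{Z}/q\mathbb{Z}$, and let $A$ be a subset of $F$ with $|A|>|F|^{1/2}$. Then $$|I(A)|\ge|F|/2.$$
   Context: For $A\subset F$, $$I(A):=\{a_1(a_2-a_3)+a_4(a_5-a_6):a_1,\dots,a_6\in A\}.$$ *)

theory Defs
  imports Complex_Main "HOL-Number_Theory.Residues"
begin

definition I_set :: "('a, 'b) ring_scheme \<Rightarrow> 'a set \<Rightarrow> 'a set" where
  "I_set R A =
    {(a1 \<otimes>\<^bsub>R\<^esub> (a2 \<ominus>\<^bsub>R\<^esub> a3)) \<oplus>\<^bsub>R\<^esub> (a4 \<otimes>\<^bsub>R\<^esub> (a5 \<ominus>\<^bsub>R\<^esub> a6)) | a1 a2 a3 a4 a5 a6.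
      a1 \<in> A \<and> a2 \<in> A \<and> a3 \<in> A \<and> a4 \<in> A \<and> a5 \<in> A \<and> a6 \<in> A}"

end

theory Submission
  imports Defs "HOL-Analysis.Convex"
begin

text \<open>
  For a unit \<open>\<xi>\<close> consider \<open>(a, b) \<mapsto> a + \<xi>b\<close> on \<open>A \<times> A\<close>. Two pairs that differ in both coordinates
  collide for at most one \<open>\<xi>\<close>, and pairs that differ in exactly one coordinate never collide, so by
  averaging over \<open>\<xi>\<close> some \<open>\<xi>\<close> has few collisions; by Cauchy--Schwarz its image has at least \<open>|F|/2\<close>
  elements. As \<open>|A|\<^sup>2 > |F|\<close>, there is still a collision \<open>a\<^sub>1 + \<xi>b\<^sub>1 = a\<^sub>2 + \<xi>b\<^sub>2\<close>, and multiplying the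
  image by \<open>b\<^sub>2 - b\<^sub>1 \<noteq> 0\<close> sends \<open>a + \<xi>b\<close> to \<open>a(b\<^sub>2 - b\<^sub>1) + b(a\<^sub>1 - a\<^sub>2)\<close>, an element of \<open>I(A)\<close>.
\<close>

text \<open>Cauchy-Schwarz on the fibre sizes of \<open>f\<close>: they sum to
  \<open>card P\<close>, and their squares sum to the number of colliding ordered pairs, diagonal
  included.\<close>

lemma card_squared_le_card_image_mult_collisions:
  assumes "finite P"
  shows "(card P)\<^sup>2 \<le> card (f ` P) * (\<Sum>x\<in>P. card {y \<in> P. f x = f y})"
proof -
  define N where "N z = card {x \<in> P. f x = z}" for z
  have fibres: "(\<Sum>x\<in>P. g (f x)) = (\<Sum>z\<in>f ` P. N z * g z)" for g :: "'b \<Rightarrow> nat"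
    unfolding sum.image_gen[OF assms, of "\<lambda>x. g (f x)" f] N_def by (intro sum.cong) auto
  have "card P = (\<Sum>z\<in>f ` P. N z)"
    using fibres[of "\<lambda>_. 1"] by simp
  moreover have "(\<Sum>x\<in>P. card {y \<in> P. f x = f y}) = (\<Sum>z\<in>f ` P. (N z)\<^sup>2)"
    using fibres[of N] by (simp add: N_def eq_commute power2_eq_square)
  moreover have "(\<Sum>z\<in>f ` P. real (N z))\<^sup>2 \<le> (\<Sum>z\<in>f ` P. (real (N z))\<^sup>2) * card (f ` P)"
    by (rule sum_squared_le_sum_of_squares)
  ultimately have "real ((card P)\<^sup>2) \<le> real (card (f ` P) * (\<Sum>x\<in>P. card {y \<in> P. f x = f y}))"
    by (simp add: mult.commute)
  then show ?thesis
    by (simp only: of_nat_le_iff)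
qed

context field
begin

text \<open>Serves twice: it determines \<xi> when \<open>b\<close> and \<open>d\<close> differ, and
  later it eliminates \<xi> in favour of elements of \<open>A\<close>.\<close>

lemma add_mult_eq_imp_minus_eq:
  assumes "a \<in> carrier R" "b \<in> carrier R" "c \<in> carrier R" "d \<in> carrier R" "\<xi> \<in> carrier R"
    and "a \<oplus> \<xi> \<otimes> b = c \<oplus> \<xi> \<otimes> d"
  shows "\<xi> \<otimes> (d \<ominus> b) = a \<ominus> c"
proof -
  \<comment> \<open>The right-hand side of the collision is exposed as a subterm, so that the
    hypothesis can be substituted between two pure ring identities.\<close>
  have "\<xi> \<otimes> (d \<ominus> b) = (c \<oplus> \<xi> \<otimes> d) \<ominus> c \<ominus> \<xi> \<otimes> b"
    using assms(1-5) by algebra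
  also have "\<dots> = (a \<oplus> \<xi> \<otimes> b) \<ominus> c \<ominus> \<xi> \<otimes> b"
    by (simp only: assms(6))
  also have "\<dots> = a \<ominus> c"
    using assms(1-5) by algebra
  finally show ?thesis .
qed

lemma minus_eq_zero_iff:
  "a \<in> carrier R \<Longrightarrow> b \<in> carrier R \<Longrightarrow> a \<ominus> b = \<zero> \<longleftrightarrow> a = b"
  using r_right_minus_eq by simp

text \<open>Since \<xi> is nonzero and a field has no zero divisors, \<open>d \<ominus> b\<close>
  and \<open>a \<ominus> c\<close> vanish together. Hence pairs differing in exactly one coordinate
  never collide.\<close>

lemma add_mult_eq_imp_eq_iff:
  assumes "a \<in> carrier R" "b \<in> carrier R" "c \<in> carrier R" "d \<in> carrier R" "\<xi> \<in> carrier R - {\<zero>}"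
    and "a \<oplus> \<xi> \<otimes> b = c \<oplus> \<xi> \<otimes> d"
  shows "a = c \<longleftrightarrow> b = d"
proof -
  have "\<xi> \<otimes> (d \<ominus> b) = a \<ominus> c"
    using assms by (intro add_mult_eq_imp_minus_eq) auto
  then have "d \<ominus> b = \<zero> \<longleftrightarrow> a \<ominus> c = \<zero>"
    using assms integral_iff[of \<xi> "d \<ominus> b"] by auto
  then show ?thesis
    using assms minus_eq_zero_iff by auto
qed

lemma card_collision_parameters_le_1:
  assumes "finite (carrier R)"
    and "a \<in> carrier R" "b \<in> carrier R" "c \<in> carrier R" "d \<in> carrier R" "b \<noteq> d"
  shows "card {\<xi> \<in> carrier R - {\<zero>}. a \<oplus> \<xi> \<otimes> b = c \<oplus> \<xi> \<otimes> d} \<le> 1"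
proof -
  have "\<xi> = \<eta>" if "\<xi> \<in> carrier R" "\<eta> \<in> carrier R"
    "a \<oplus> \<xi> \<otimes> b = c \<oplus> \<xi> \<otimes> d" "a \<oplus> \<eta> \<otimes> b = c \<oplus> \<eta> \<otimes> d" for \<xi> \<eta>
  proof -
    have "\<xi> \<otimes> (d \<ominus> b) = \<eta> \<otimes> (d \<ominus> b)"
      using add_mult_eq_imp_minus_eq[of a b c d \<xi>] add_mult_eq_imp_minus_eq[of a b c d \<eta>]
        assms that by simp
    then show ?thesis
      using m_rcancel[of "d \<ominus> b" \<xi> \<eta>] minus_eq_zero_iff[of d b] assms that by auto
  qed
  then show ?thesis
    using assms(1) by (subst One_nat_def, subst card_le_Suc0_iff_eq) auto
qed

text \<open>Swap the sums and fix \<open>x\<close>: the pair \<open>x\<close> itself collides for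
  all |F| - 1 parameters, pairs sharing exactly one coordinate with it for none, and each of the
  (|A| - 1)^2 remaining pairs for at most one.\<close>

lemma sum_collisions_le:
  assumes fin: "finite (carrier R)" and A: "A \<subseteq> carrier R"
  defines "f \<equiv> \<lambda>\<xi> p. fst p \<oplus> \<xi> \<otimes> snd p"
  shows "(\<Sum>\<xi>\<in>carrier R - {\<zero>}. \<Sum>x\<in>A \<times> A. card {y \<in> A \<times> A. f \<xi> x = f \<xi> y})
    \<le> (card A)\<^sup>2 * (card (carrier R) - 1 + (card A - 1)\<^sup>2)"
proof -
  define U where "U = carrier R - {\<zero>}"
  define g where "g x y = card {\<xi> \<in> U. f \<xi> x = f \<xi> y}" for x y
  have finA: "finite A" and finU: "finite U"
    using fin A finite_subset by (auto simp: U_def)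
  have cardU: "card U = card (carrier R) - 1"
    using fin by (simp add: U_def)
  have inner: "(\<Sum>y\<in>A \<times> A. g x y) \<le> card (carrier R) - 1 + (card A - 1)\<^sup>2"
    if x: "x \<in> A \<times> A" for x
  proof -
    obtain a b where ab: "x = (a, b)" "a \<in> A" "b \<in> A"
      using x by auto
    \<comment> \<open>The pairs that differ from \<open>x\<close> in both coordinates.\<close>
    define D where "D = (A - {a}) \<times> (A - {b})"
    have zero: "g x y = 0" if "y \<in> A \<times> A - insert x D" for y
    proof -
      obtain c d where cd: "y = (c, d)" "c \<in> A" "d \<in> A" "(a = c) \<noteq> (b = d)"
        using \<open>y \<in> A \<times> A - insert x D\<close> by (auto simp: D_def ab)
      have "{\<xi> \<in> U. f \<xi> x = f \<xi> y} = {}"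
        using add_mult_eq_imp_eq_iff[of a b c d] ab cd A by (auto simp: U_def f_def)
      then show ?thesis
        by (simp only: g_def card.empty)
    qed
    have one: "g x y \<le> 1" if "y \<in> D" for y
    proof -
      obtain c d where cd: "y = (c, d)" "c \<in> A" "d \<in> A" "b \<noteq> d"
        using \<open>y \<in> D\<close> by (auto simp: D_def)
      have "a \<in> carrier R" "b \<in> carrier R" "c \<in> carrier R" "d \<in> carrier R"
        using ab cd A by auto
      from card_collision_parameters_le_1[OF fin this \<open>b \<noteq> d\<close>] show ?thesis
        by (simp add: g_def f_def U_def ab cd)
    qed
    have "(\<Sum>y\<in>A \<times> A. g x y) = (\<Sum>y\<in>insert x D. g x y)"
      using finA x zero by (intro sum.mono_neutral_right) (auto simp: D_def)
    also have "\<dots> = g x x + (\<Sum>y\<in>D. g x y)"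
      using finA by (subst sum.insert) (auto simp: D_def ab)
    also have "\<dots> \<le> card U + (\<Sum>y\<in>D. 1)"
      using one by (intro add_mono sum_mono) (auto simp: g_def)
    also have "\<dots> = card (carrier R) - 1 + (card A - 1)\<^sup>2"
      using ab by (simp add: cardU D_def card_cartesian_product power2_eq_square)
    finally show ?thesis .
  qed
  have "(\<Sum>\<xi>\<in>U. \<Sum>x\<in>A \<times> A. card {y \<in> A \<times> A. f \<xi> x = f \<xi> y})
      = (\<Sum>x\<in>A \<times> A. \<Sum>\<xi>\<in>U. card {y \<in> A \<times> A. f \<xi> x = f \<xi> y})"
    by (rule sum.swap)
  \<comment> \<open>Double counting: for fixed \<open>x\<close>, the collisions (\<xi>, y) are
    grouped by \<open>y\<close> instead of by \<xi>.\<close>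
  also have "\<dots> = (\<Sum>x\<in>A \<times> A. \<Sum>y\<in>A \<times> A. g x y)"
    unfolding g_def using finA finU
    by (intro sum.cong refl sum_multicount_gen) auto
  also have "\<dots> \<le> (\<Sum>x\<in>A \<times> A. card (carrier R) - 1 + (card A - 1)\<^sup>2)"
    by (rule sum_mono) (rule inner)
  also have "\<dots> = (card A)\<^sup>2 * (card (carrier R) - 1 + (card A - 1)\<^sup>2)"
    by (simp add: card_cartesian_product power2_eq_square)
  finally show ?thesis
    by (simp only: U_def)
qed

text \<open>If every image were smaller than q/2, Cauchy-Schwarz would force 2n^4 \<le> (q - 1)
  E(\<xi>) for each of the q - 1 units. Summing gives at least 2n^4 collisions in total, more than
  \<open>sum_collisions_le\<close> allows.\<close>

lemma exists_large_dilated_sumset: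
  assumes fin: "finite (carrier R)" and A: "A \<subseteq> carrier R"
    and large: "card (carrier R) < (card A)\<^sup>2"
  shows "\<exists>\<xi>\<in>carrier R - {\<zero>}.
    card (carrier R) \<le> 2 * card ((\<lambda>p. fst p \<oplus> \<xi> \<otimes> snd p) ` (A \<times> A))"
proof (rule ccontr)
  define f where "f \<xi> p = fst p \<oplus> \<xi> \<otimes> snd p" for \<xi> and p :: "'a \<times> 'a"
  define E where "E \<xi> = (\<Sum>x\<in>A \<times> A. card {y \<in> A \<times> A. f \<xi> x = f \<xi> y})" for \<xi>
  define U where "U = carrier R - {\<zero>}"
  define n where "n = card A"
  define q where "q = card (carrier R)"
  have finA: "finite A"
    using fin A finite_subset by blast
  have "card {\<zero>, \<one>} \<le> q"
    unfolding q_def using fin by (intro card_mono) auto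
  then have q2: "2 \<le> q"
    by simp
  have cardU: "card U = q - 1"
    using fin by (simp add: U_def q_def)
  have nq: "q < n\<^sup>2"
    using large by (simp add: n_def q_def)
  have n2: "2 \<le> n"
  proof (rule ccontr)
    assume "\<not> 2 \<le> n"
    then have "n = 0 \<or> n = 1"
      by auto
    then show False
      using nq q2 by auto
  qed
  assume "\<not> (\<exists>\<xi>\<in>carrier R - {\<zero>}.
    card (carrier R) \<le> 2 * card ((\<lambda>p. fst p \<oplus> \<xi> \<otimes> snd p) ` (A \<times> A)))"
  \<comment> \<open>Integrality turns < q into \<le> q - 1, which is exactly the number of units and
    so cancels after summation.\<close>
  then have small: "2 * card (f \<xi> ` (A \<times> A)) \<le> q - 1" if "\<xi> \<in> U" for \<xi>
    using that by (force simp: U_def f_def[abs_def] q_def)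
  have "2 * n ^ 4 \<le> (q - 1) * E \<xi>" if "\<xi> \<in> U" for \<xi>
  proof -
    have "n ^ 4 \<le> card (f \<xi> ` (A \<times> A)) * E \<xi>"
      using card_squared_le_card_image_mult_collisions[of "A \<times> A" "f \<xi>"] finA
      by (simp add: E_def n_def card_cartesian_product flip: power2_eq_square power_mult)
    then have "2 * n ^ 4 \<le> (2 * card (f \<xi> ` (A \<times> A))) * E \<xi>"
      by simp
    also have "\<dots> \<le> (q - 1) * E \<xi>"
      by (rule mult_right_mono) (use small[OF that] in auto)
    finally show ?thesis .
  qed
  then have "(\<Sum>\<xi>\<in>U. 2 * n ^ 4) \<le> (\<Sum>\<xi>\<in>U. (q - 1) * E \<xi>)"
    by (rule sum_mono)
  then have "(q - 1) * (2 * n ^ 4) \<le> (q - 1) * (\<Sum>\<xi>\<in>U. E \<xi>)"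
    by (simp add: cardU flip: sum_distrib_left)
  then have "2 * n ^ 4 \<le> (\<Sum>\<xi>\<in>U. E \<xi>)"
    using q2 by simp
  also have "\<dots> \<le> n\<^sup>2 * (q - 1 + (n - 1)\<^sup>2)"
    using sum_collisions_le[OF fin A] by (simp add: E_def f_def U_def n_def q_def)
  finally have "n\<^sup>2 * (2 * n\<^sup>2) \<le> n\<^sup>2 * (q - 1 + (n - 1)\<^sup>2)"
    by (simp add: power2_eq_square power4_eq_xxxx mult_ac)
  then have "2 * n\<^sup>2 \<le> q - 1 + (n - 1)\<^sup>2"
    using n2 by simp
  \<comment> \<open>The hypothesis q < n^2 bounds the first term, with strictness; (n - 1)^2 \<le>
    n^2 bounds the second.\<close>
  also have "\<dots> < n\<^sup>2 + n\<^sup>2"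
    using nq power_mono[of "n - 1" n 2] by linarith
  finally show False
    by simp
qed

text \<open>A collision exists by pigeonhole, and multiplication by its nonzero difference
  \<open>d \<ominus> b\<close> embeds the image into \<open>I_set R A\<close>.\<close>

lemma card_dilated_sumset_le_card_I_set:
  assumes fin: "finite (carrier R)" and A: "A \<subseteq> carrier R"
    and large: "card (carrier R) < (card A)\<^sup>2" and \<xi>: "\<xi> \<in> carrier R - {\<zero>}"
  shows "card ((\<lambda>p. fst p \<oplus> \<xi> \<otimes> snd p) ` (A \<times> A)) \<le> card (I_set R A)"
proof -
  define f where "f p = fst p \<oplus> \<xi> \<otimes> snd p" for p :: "'a \<times> 'a"
  have f_car: "f ` (A \<times> A) \<subseteq> carrier R"
    using A \<xi> by (auto simp: f_def subset_iff)
  have "card (f ` (A \<times> A)) < card (A \<times> A)"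
    using card_mono[OF fin f_car] large by (simp add: card_cartesian_product power2_eq_square)
  then have "\<not> inj_on f (A \<times> A)"
    by (rule pigeonhole)
  then obtain a b c d where abcd: "a \<in> A" "b \<in> A" "c \<in> A" "d \<in> A"
    and coll: "a \<oplus> \<xi> \<otimes> b = c \<oplus> \<xi> \<otimes> d" and ne: "(a, b) \<noteq> (c, d)"
    by (auto simp: inj_on_def f_def)
  have car: "a \<in> carrier R" "b \<in> carrier R" "c \<in> carrier R" "d \<in> carrier R" "\<xi> \<in> carrier R"
    using abcd A \<xi> by auto
  \<comment> \<open>Otherwise \<open>a = c\<close> as well, and the two colliding pairs would
    coincide.\<close>
  have "b \<noteq> d"
    using add_mult_eq_imp_eq_iff[OF car(1-4) \<xi> coll] ne by auto
  then have nz: "d \<ominus> b \<noteq> \<zero>"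
    using minus_eq_zero_iff car by auto
  have "(\<lambda>z. (d \<ominus> b) \<otimes> z) ` f ` (A \<times> A) \<subseteq> I_set R A"
  proof clarsimp
    fix u v assume uv: "u \<in> A" "v \<in> A"
    then have uv_car: "u \<in> carrier R" "v \<in> carrier R"
      using A by auto
    have "(d \<ominus> b) \<otimes> f (u, v) = u \<otimes> (d \<ominus> b) \<oplus> v \<otimes> (\<xi> \<otimes> (d \<ominus> b))"
      unfolding f_def fst_conv snd_conv using car uv_car by algebra
    \<comment> \<open>The collision replaces the factor containing \<xi> by a difference of elements
      of \<open>A\<close>.\<close>
    also have "\<dots> = u \<otimes> (d \<ominus> b) \<oplus> v \<otimes> (a \<ominus> c)"
      using add_mult_eq_imp_minus_eq[OF car coll] by simp
    finally show "(d \<ominus> b) \<otimes> f (u, v) \<in> I_set R A"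
      using abcd uv unfolding I_set_def by blast
  qed
  moreover have "finite (I_set R A)"
  proof (rule finite_subset[OF _ fin])
    show "I_set R A \<subseteq> carrier R"
      using A unfolding I_set_def by (auto simp: subset_iff)
  qed
  moreover have "inj_on (\<lambda>z. (d \<ominus> b) \<otimes> z) (f ` (A \<times> A))"
  proof (rule inj_onI)
    fix z w assume "z \<in> f ` (A \<times> A)" "w \<in> f ` (A \<times> A)" "(d \<ominus> b) \<otimes> z = (d \<ominus> b) \<otimes> w"
    then show "z = w"
      using m_lcancel[OF nz, of z w] f_car car by auto
  qed
  ultimately have "card (f ` (A \<times> A)) \<le> card (I_set R A)"
    by (metis card_image card_mono)
  then show ?thesis
    by (simp add: f_def[abs_def])
qed

theorem card_carrier_le_twice_card_I_set:
  assumes "finite (carrier R)" "A \<subseteq> carrier R" "card (carrier R) < (card A)\<^sup>2"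
  shows "card (carrier R) \<le> 2 * card (I_set R A)"
  using exists_large_dilated_sumset[OF assms] card_dilated_sumset_le_card_I_set[OF assms]
  by fastforce

end

theorem theorem3:
  fixes q :: nat and F :: "int ring" and A :: "int set"
  assumes "prime q"
    and "F = residue_ring (int q)"
    and "A \<subseteq> carrier F"
    and "real (card A) > sqrt (real (card (carrier F)))"
  shows "real (card (I_set F A)) \<ge> real (card (carrier F)) / 2"
proof -
  \<comment> \<open>This makes \<open>F\<close> a finite field. The locale introduces its ring by a
    meta-level definition, hence \<open>eq_reflection\<close>.\<close>
  interpret residues_prime q F
    by unfold_locales (fact assms(1), rule eq_reflection, fact assms(2))
  have "real (card (carrier F)) < (real (card A))\<^sup>2"
    using assms(4) by (meson not_less real_le_rsqrt)
  then have "card (carrier F) < (card A)\<^sup>2"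
    by (simp only: flip: of_nat_power of_nat_less_iff[where 'a = real])
  then have "card (carrier F) \<le> 2 * card (I_set F A)"
    using assms(3) by (intro card_carrier_le_twice_card_I_set) auto
  then show ?thesis
    by linarith
qed

end
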